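(* Let $X$ be a compact Hausdorff space, let $\mathbb{K}=\mathbb{R}$ or $\mathbb{K}=\mathbb{C}$, and let $A=C(X,\mathbb{K})$. Then $$\operatorname{bsr}A=\operatorname{usr}A=\operatorname{aur}A=\operatorname{tsr}A=\operatorname{snr}A=\operatorname{nor}A.$$
   Context: $C(X,\mathbb{K})$ is the algebra of continuous $\mathbb{K}$-valued functions on $X$, with the supremum norm and the induced topology. For a commutative unital ring $R$ and an integer $n\ge 1$, let $U_n(R)=\{(f_1,\dots,f_n)\in R^n:\ \sum_{j=1}^n Rf_j=R\}$ be the set of invertible $n$-tuples, and let $R^{-1}$ be the set of units of $R$. For $\boldsymbol f,\boldsymbol x\in R^n$ and $g\in R$, $\boldsymbol f+\boldsymbol x\,g$ means $(f_1+x_1g,\dots,f_n+x_ng)$. The following ranks take values in $\{1,2,3,\dots\}\cup\{\infty\}$; each is the smallest integer $n\ge 1$ with the stated property, and $\infty$ if there is no such $n$. - Bass stable rank $\operatorname{bsr}R$: for every $(\boldsymbol f,g)\in U_{n+1}(R)$ there is $\boldsymbol x\in R^n$ with $\boldsymbol f+\boldsymbol x\,g\in U_n(R)$. - Unitary $M$-stable rank $\operatorname{usr}R$: for every $(\boldsymbol f,g)\in U_{n+1}(R)$ there is $\boldsymbol u\in U_n(R)$ with $\boldsymbol f+\boldsymbol u\,g\in U_n(R)$. - All-units rank $\operatorname{aur}R$: for every $(\boldsymbol f,g)\in U_{n+1}(R)$ there are $u_1,\dots,u_n\in R^{-1}$ with $\boldsymbol f+(u_1,\dots,u_n)\,g\in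 U_n(R)$. - Topological stable rank $\operatorname{tsr}R$ ($R$ carrying a topology): $U_n(R)$ is dense in $R^n$. - Small-norm rank $\operatorname{snr}A$ ($A=(A,\|\cdot\|)$ a commutative unital normed algebra): for every $\varepsilon>0$ and every $(\boldsymbol f,g)\in U_{n+1}(A)$ there is $\boldsymbol a=(a_1,\dots,a_n)\in A^n$ with $\|a_j\|<\varepsilon$ for all $j$ and $\boldsymbol f+\boldsymbol a\,g\in U_n(A)$. - Norm-one rank $\operatorname{nor}A$ ($A$ a commutative unital normed algebra): for every $(\boldsymbol f,g)\in U_{n+1}(A)$ there is $\boldsymbol c=(c_1,\dots,c_n)\in A^n$ with $\|c_j\|=1$ for all $j$ and $\boldsymbol f+\boldsymbol c\,g\in U_n(A)$. *)

theory Defs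
  imports "HOL-Analysis.Analysis"
begin

section \<open>The algebra of bounded continuous functions\<close>

text \<open>
  The type of bounded continuous functions carries the supremum norm, but in the library it is only
  a normed vector space; we add the pointwise multiplication. On a compact space every continuous
  function is bounded (lemma \<open>continuous_imp_bcontfun\<close>), so there this type is the whole algebra
  \<open>C(X, K)\<close>.
\<close>

lemma continuous_imp_bcontfun:
  fixes f :: "'x::topological_space \<Rightarrow> 'b::metric_space"
  assumes "compact (UNIV :: 'x set)" and "continuous_on UNIV f"
  shows "f \<in> bcontfun"
  using assms by (auto simp: bcontfun_def intro: compact_imp_bounded compact_continuous_image)

lemma times_cont:
  fixes f g :: "'x::topological_space \<Rightarrow> 'b::real_normed_algebra"
  assumes "f \<in> bcontfun" and "g \<in> bcontfun"
  shows "(\<lambda>x. f x * g x) \<in> bcontfun"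
proof -
  have cont: "continuous_on UNIV f" "continuous_on UNIV g"
    using assms by (auto simp: bcontfun_def)
  obtain a b where a: "\<And>x. norm (f x) \<le> a" and b: "\<And>x. norm (g x) \<le> b"
    using assms by (auto simp: bcontfun_def bounded_iff)
  have "norm (f x * g x) \<le> a * b" for x
    using norm_mult_ineq[of "f x" "g x"]
      mult_mono[OF a[of x] b[of x] order_trans[OF norm_ge_zero a[of x]] norm_ge_zero]
    by (rule order_trans)
  with cont show ?thesis
    by (intro bcontfun_normI[where b = "a * b"] continuous_intros)
qed

instantiation bcontfun :: (topological_space, real_normed_field) comm_ring_1
begin

definition one_bcontfun :: "'a \<Rightarrow>\<^sub>C 'b"
  where "one_bcontfun = const_bcontfun 1"

definition times_bcontfun :: "('a \<Rightarrow>\<^sub>C 'b) \<Rightarrow> ('a \<Rightarrow>\<^sub>C 'b) \<Rightarrow> 'a \<Rightarrow>\<^sub>C 'b"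
  where "times_bcontfun f g = Bcontfun (\<lambda>x. f x * g x)"

lemma apply_one_bcontfun [simp]: "apply_bcontfun (1 :: 'a \<Rightarrow>\<^sub>C 'b) x = 1"
  by (simp add: one_bcontfun_def)

lemma apply_times_bcontfun [simp]:
  "apply_bcontfun (f * g) x = apply_bcontfun f x * apply_bcontfun g x" for f g :: "'a \<Rightarrow>\<^sub>C 'b"
  by (simp add: times_bcontfun_def Bcontfun_inverse times_cont apply_bcontfun)

instance
proof
  show "(0 :: 'a \<Rightarrow>\<^sub>C 'b) \<noteq> 1"
  proof
    assume "(0 :: 'a \<Rightarrow>\<^sub>C 'b) = 1"
    then have "apply_bcontfun (0 :: 'a \<Rightarrow>\<^sub>C 'b) undefined = apply_bcontfun 1 undefined"
      by simp
    then show False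
      by simp
  qed
qed (auto intro!: bcontfun_eqI simp: algebra_simps)

end

instance bcontfun :: (topological_space, real_normed_field) real_normed_algebra_1
proof
  fix f g :: "'a \<Rightarrow>\<^sub>C 'b" and r :: real
  show "norm (f * g) \<le> norm f * norm g"
    by (rule norm_bound) (simp add: norm_mult mult_mono norm_bounded)
  show "norm (1 :: 'a \<Rightarrow>\<^sub>C 'b) = 1"
  proof (rule antisym)
    show "norm (1 :: 'a \<Rightarrow>\<^sub>C 'b) \<le> 1"
      by (rule norm_bound) simp
    show "1 \<le> norm (1 :: 'a \<Rightarrow>\<^sub>C 'b)"
      using norm_bounded[of "1 :: 'a \<Rightarrow>\<^sub>C 'b" undefined] by simp
  qed
qed (auto intro!: bcontfun_eqI)


section \<open>Invertible tuples\<close>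

text \<open>
  An \<open>n\<close>-tuple is an extensional function on \<open>{..<n}\<close>; the \<open>(n + 1)\<close>-tuple \<open>(f, g)\<close> obtained by
  appending \<open>g\<close> to the \<open>n\<close>-tuple \<open>f\<close> is \<open>f(n := g)\<close>.
\<close>

definition tuples :: "nat \<Rightarrow> 'a set \<Rightarrow> (nat \<Rightarrow> 'a) set"
  where "tuples n S = ({..<n} \<rightarrow>\<^sub>E S)"

definition invertible_tuples :: "nat \<Rightarrow> (nat \<Rightarrow> 'a::comm_ring_1) set"
  where "invertible_tuples n =
    {f \<in> tuples n UNIV. {(\<Sum>j<n. r j * f j) |r. r \<in> tuples n UNIV} = UNIV}"

definition add_mult :: "nat \<Rightarrow> (nat \<Rightarrow> 'a::comm_ring_1) \<Rightarrow> (nat \<Rightarrow> 'a) \<Rightarrow> 'a \<Rightarrow> nat \<Rightarrow> 'a"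
  where "add_mult n f x g = (\<lambda>j\<in>{..<n}. f j + x j * g)"


section \<open>Stable ranks\<close>

definition least_rank :: "(nat \<Rightarrow> bool) \<Rightarrow> enat"
  where "least_rank P = (if \<exists>n\<ge>1. P n then enat (LEAST n. n \<ge> 1 \<and> P n) else \<infinity>)"

text \<open>
  The ring \<open>R\<close> is the type \<open>'a\<close>, passed as an argument of type \<open>'a itself\<close>.
\<close>

definition bsr :: "'a::comm_ring_1 itself \<Rightarrow> enat"
  where "bsr _ = least_rank (\<lambda>n.
    \<forall>f \<in> tuples n UNIV. \<forall>g::'a. f(n := g) \<in> invertible_tuples (Suc n) \<longrightarrow>
      (\<exists>x \<in> tuples n UNIV. add_mult n f x g \<in> invertible_tuples n))"

definition usr :: "'a::comm_ring_1 itself \<Rightarrow> enat"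
  where "usr _ = least_rank (\<lambda>n.
    \<forall>f \<in> tuples n UNIV. \<forall>g::'a. f(n := g) \<in> invertible_tuples (Suc n) \<longrightarrow>
      (\<exists>u \<in> invertible_tuples n. add_mult n f u g \<in> invertible_tuples n))"

definition aur :: "'a::comm_ring_1 itself \<Rightarrow> enat"
  where "aur _ = least_rank (\<lambda>n.
    \<forall>f \<in> tuples n UNIV. \<forall>g::'a. f(n := g) \<in> invertible_tuples (Suc n) \<longrightarrow>
      (\<exists>u \<in> tuples n {v. v dvd 1}. add_mult n f u g \<in> invertible_tuples n))"

definition tsr :: "'a::{comm_ring_1, topological_space} itself \<Rightarrow> enat"
  where "tsr _ = least_rank (\<lambda>n.
    product_topology (\<lambda>_. euclidean) {..<n} closure_of invertible_tuples n
      = (tuples n UNIV :: (nat \<Rightarrow> 'a) set))"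

definition snr :: "'a::{comm_ring_1, real_normed_algebra_1} itself \<Rightarrow> enat"
  where "snr _ = least_rank (\<lambda>n. \<forall>\<epsilon>>0.
    \<forall>f \<in> tuples n UNIV. \<forall>g::'a. f(n := g) \<in> invertible_tuples (Suc n) \<longrightarrow>
      (\<exists>a \<in> tuples n UNIV. (\<forall>j<n. norm (a j) < \<epsilon>) \<and> add_mult n f a g \<in> invertible_tuples n))"

definition nor :: "'a::{comm_ring_1, real_normed_algebra_1} itself \<Rightarrow> enat"
  where "nor _ = least_rank (\<lambda>n.
    \<forall>f \<in> tuples n UNIV. \<forall>g::'a. f(n := g) \<in> invertible_tuples (Suc n) \<longrightarrow>
      (\<exists>c \<in> tuples n UNIV. (\<forall>j<n. norm (c j) = 1) \<and> add_mult n f c g \<in> invertible_tuples n))"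

end

theory Submission
  imports Defs
begin

text \<open>
  A tuple in \<open>C(X, K)\<close> is invertible iff its entries have no common zero. For every \<open>n \<ge> 1\<close> the six
  rank conditions are equivalent. The Bass condition, applied to \<open>f\<close> and a cut-off supported near
  the common zeros of \<open>f\<close>, yields after renormalisation a zero-free tuple close to \<open>f\<close>, i.e. density.
  Density lets one correct \<open>f\<close> by a small multiple of \<open>g\<close>. Perturbing \<open>\<plusminus>1\<close> by such small functions
  gives units of norm one, which serve for all the remaining conditions, each of which
  trivially implies the Bass condition.
\<close>

section \<open>Continuous functions on a compact space, and conjugation of scalars\<close>

lemma apply_Bcontfun_compact:
  fixes h :: "'x::topological_space \<Rightarrow> 'b::metric_space"
  assumes "compact (UNIV :: 'x set)" "continuous_on UNIV h"
  shows "apply_bcontfun (Bcontfun h) x = h x"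
  by (simp add: Bcontfun_inverse assms continuous_imp_bcontfun)

lemma continuous_on_apply_bcontfun_UNIV [continuous_intros]:
  "continuous_on UNIV (\<lambda>x. apply_bcontfun f x)"
  by (rule continuous_on_apply_bcontfun)

lemma compact_positive_lower_bound:
  fixes h :: "'x::topological_space \<Rightarrow> real"
  assumes "compact (UNIV :: 'x set)" "continuous_on UNIV h" "\<And>x. 0 < h x"
  obtains \<delta> where "0 < \<delta>" "\<And>x. \<delta> \<le> h x"
proof -
  obtain x0 where "\<forall>x. h x0 \<le> h x"
    using continuous_attains_inf[OF assms(1) UNIV_not_empty assms(2)] by auto
  with assms(3) show ?thesis
    using that by blast
qed

text \<open>Since \<open>0 / 0 = 0\<close>, this is complex conjugation on \<open>\<real>\<close> and on \<open>\<complex>\<close>, also at \<open>0\<close>.\<close>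

definition conjug :: "'k::real_normed_field \<Rightarrow> 'k"
  where "conjug z = of_real ((norm z)\<^sup>2) / z"

lemma conjug_mult: "conjug z * z = of_real ((norm z)\<^sup>2)"
  by (cases "z = 0") (simp_all add: conjug_def)

lemma norm_conjug: "norm (conjug z) = norm z"
  by (cases "z = 0") (simp_all add: conjug_def norm_divide norm_mult power2_eq_square)

lemma isCont_conjug: "isCont conjug z"
proof (cases "z = 0")
  case True
  have "(conjug \<longlongrightarrow> 0) (at (0::'a))"
    by (rule Lim_null_comparison[where g = norm])
       (auto simp: norm_conjug intro!: tendsto_eq_intros)
  then show ?thesis
    using True by (simp add: isCont_def conjug_def)
next
  case False
  have "isCont (\<lambda>z::'a. of_real ((norm z)\<^sup>2) / z) z"
    using False by (intro continuous_intros) auto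
  then show ?thesis
    by (simp add: conjug_def[abs_def])
qed

lemma continuous_on_conjug [continuous_intros]:
  "continuous_on S h \<Longrightarrow> continuous_on S (\<lambda>x. conjug (h x))"
  by (rule continuous_on_compose2[of UNIV])
     (auto intro: continuous_at_imp_continuous_on isCont_conjug)

section \<open>Invertibility as absence of common zeros\<close>

lemma apply_bcontfun_sum:
  fixes f :: "'i \<Rightarrow> 'x::topological_space \<Rightarrow>\<^sub>C 'k::real_normed_vector"
  shows "apply_bcontfun (\<Sum>j\<in>J. f j) x = (\<Sum>j\<in>J. apply_bcontfun (f j) x)"
  by (induction J rule: infinite_finite_induct) simp_all

text \<open>At a common zero, a representation of 1 would read 1 = 0. Conversely, \<open>N\<close>,
  the sum of the squared norms, never vanishes, and the functions
  \<open>conjug (f j x) / of_real (N x)\<close> are coefficients that represent 1; multiplying them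
  by \<open>h\<close> represents \<open>h\<close>.\<close>

lemma invertible_tuples_iff:
  fixes f :: "nat \<Rightarrow> 'x::topological_space \<Rightarrow>\<^sub>C 'k::real_normed_field"
  assumes "compact (UNIV :: 'x set)"
  shows "f \<in> invertible_tuples n \<longleftrightarrow> f \<in> tuples n UNIV \<and> (\<forall>x. \<exists>j<n. f j x \<noteq> 0)"
proof safe
  assume "f \<in> invertible_tuples n"
  then show "f \<in> tuples n UNIV"
    by (simp add: invertible_tuples_def)
  fix x
  from \<open>f \<in> invertible_tuples n\<close>
  have "1 \<in> {(\<Sum>j<n. r j * f j) |r. r \<in> tuples n UNIV}"
    by (simp add: invertible_tuples_def)
  then obtain r where "1 = (\<Sum>j<n. r j * f j)"
    by blast
  from arg_cong[OF this, of "\<lambda>h. apply_bcontfun h x"]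
  have "1 = (\<Sum>j<n. r j x * f j x)"
    by (simp add: apply_bcontfun_sum)
  then show "\<exists>j<n. f j x \<noteq> 0"
    by (metis (no_types, lifting) lessThan_iff mult_zero_right sum.neutral zero_neq_one)
next
  assume f: "f \<in> tuples n UNIV" and nz: "\<forall>x. \<exists>j<n. f j x \<noteq> 0"
  define N where "N x = (\<Sum>j<n. (norm (f j x))\<^sup>2)" for x
  have N: "N x \<noteq> 0" for x
    using nz by (auto simp: N_def sum_nonneg_eq_0_iff)
  have cont_N: "continuous_on UNIV N"
    unfolding N_def by (intro continuous_intros)
  have "\<exists>r. h = (\<Sum>j<n. r j * f j) \<and> r \<in> tuples n UNIV" for h
  proof (intro exI conjI)
    let ?q = "\<lambda>j x. apply_bcontfun h x * (conjug (f j x) / of_real (N x))"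
    let ?r = "\<lambda>j\<in>{..<n}. Bcontfun (?q j)"
    have cont_q: "continuous_on UNIV (?q j)" for j
      by (intro continuous_intros cont_N) (simp add: N)
    have "(\<Sum>j<n. ?r j * f j) x = h x" for x
    proof -
      have "(\<Sum>j<n. ?r j * f j) x = (\<Sum>j<n. h x * of_real ((norm (f j x))\<^sup>2 / N x))"
        by (simp add: apply_bcontfun_sum apply_Bcontfun_compact[OF assms cont_q, simplified]
            conjug_mult mult.assoc)
      also have "\<dots> = h x * of_real (N x / N x)"
        unfolding N_def sum_divide_distrib by (simp add: sum_distrib_left)
      finally show ?thesis
        using N[of x] by simp
    qed
    then show "h = (\<Sum>j<n. ?r j * f j)"
      by (intro bcontfun_eqI) simp
    show "?r \<in> tuples n UNIV"
      by (simp add: tuples_def)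
  qed
  with f show "f \<in> invertible_tuples n"
    by (auto simp: invertible_tuples_def)
qed

lemma invertible_tuples_append_iff:
  fixes f :: "nat \<Rightarrow> 'x::topological_space \<Rightarrow>\<^sub>C 'k::real_normed_field"
  assumes "compact (UNIV :: 'x set)" "f \<in> tuples n UNIV"
  shows "f(n := g) \<in> invertible_tuples (Suc n) \<longleftrightarrow> (\<forall>x. (\<exists>j<n. f j x \<noteq> 0) \<or> g x \<noteq> 0)"
proof -
  have "f(n := g) \<in> tuples (Suc n) UNIV"
    using assms(2) by (auto simp: tuples_def PiE_def extensional_def)
  then show ?thesis
    by (auto simp: invertible_tuples_iff[OF assms(1)] less_Suc_eq)
qed

lemma add_mult_in_invertible_tuples_iff:
  fixes f :: "nat \<Rightarrow> 'x::topological_space \<Rightarrow>\<^sub>C 'k::real_normed_field"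
  assumes "compact (UNIV :: 'x set)"
  shows "add_mult n f a g \<in> invertible_tuples n \<longleftrightarrow> (\<forall>x. \<exists>j<n. f j x + a j x * g x \<noteq> 0)"
  by (auto simp: invertible_tuples_iff[OF assms] add_mult_def tuples_def)

text \<open>The reciprocal is continuous, and compactness makes it bounded, so it lies in the
  algebra.\<close>

lemma unit_bcontfunI:
  fixes c :: "'x::topological_space \<Rightarrow>\<^sub>C 'k::real_normed_field"
  assumes "compact (UNIV :: 'x set)" "\<And>x. c x \<noteq> 0"
  shows "c dvd 1"
proof
  have "continuous_on UNIV (\<lambda>x. 1 / c x)"
    by (intro continuous_intros) (use assms in auto)
  then show "1 = c * Bcontfun (\<lambda>x. 1 / c x)"
    by (intro bcontfun_eqI) (simp add: apply_Bcontfun_compact assms)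
qed

section \<open>From the Bass condition through density and small norms to units of norm one\<close>

text \<open>
  The cut-off \<open>g\<close> vanishes where \<open>\<parallel>f\<parallel>\<^sub>1 \<ge> \<epsilon>\<close>, so \<open>F = f + x g\<close> agrees with \<open>f\<close> there; elsewhere only
  the direction of \<open>F\<close> is kept and its length is reset to \<open>\<epsilon>\<close>.
\<close>

lemma bass_imp_approximable:
  fixes f :: "nat \<Rightarrow> 'x::topological_space \<Rightarrow>\<^sub>C 'k::real_normed_field"
  assumes X: "compact (UNIV :: 'x set)"
    and bass: "\<And>(f :: nat \<Rightarrow> 'x \<Rightarrow>\<^sub>C 'k) g. f \<in> tuples n UNIV \<Longrightarrow>
      f(n := g) \<in> invertible_tuples (Suc n) \<Longrightarrow> \<exists>x. add_mult n f x g \<in> invertible_tuples n"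
    and f: "f \<in> tuples n UNIV" and "\<epsilon> > 0"
  shows "\<exists>u \<in> invertible_tuples n. \<forall>j<n. norm (u j - f j) < \<epsilon>"
proof -
  \<comment> \<open>Where \<open>m x < e\<close>, both \<open>u j x\<close> and \<open>f j x\<close>
    will have norm at most \<open>e\<close>, so they differ by at most \<open>2 * e\<close>, which
    has to stay below \<epsilon>.\<close>
  define e where "e = \<epsilon> / 3"
  have e: "e > 0" "2 * e < \<epsilon>"
    using \<open>\<epsilon> > 0\<close> by (auto simp: e_def)
  define m where "m x = (\<Sum>j<n. norm (f j x))" for x
  have cont_m: "continuous_on UNIV m"
    unfolding m_def by (intro continuous_intros)
  define g where "g = Bcontfun (\<lambda>x. of_real (max 0 (e - m x)) :: 'k)"
  have g: "g x = of_real (max 0 (e - m x))" for x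
    unfolding g_def by (intro apply_Bcontfun_compact X continuous_intros cont_m)
  \<comment> \<open>At a common zero of \<open>f\<close> the sum \<open>m\<close> is 0, so
    \<open>g\<close> takes the value \<open>e\<close> there.\<close>
  have "f(n := g) \<in> invertible_tuples (Suc n)"
    unfolding invertible_tuples_append_iff[OF X f]
  proof
    fix x
    have "m x = 0" if "\<forall>j<n. f j x = 0"
      unfolding m_def using that by (intro sum.neutral) simp
    then show "(\<exists>j<n. f j x \<noteq> 0) \<or> g x \<noteq> 0"
      using e by (auto simp: g)
  qed
  from bass[OF f this] obtain y where "add_mult n f y g \<in> invertible_tuples n" ..
  then have y: "\<exists>j<n. f j x + y j x * g x \<noteq> 0" for x
    unfolding add_mult_in_invertible_tuples_iff[OF X] ..
  define F where "F j = f j + y j * g" for j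
  define M where "M x = (\<Sum>j<n. norm (F j x))" for x
  have M: "M x > 0" for x
  proof -
    have "M x \<noteq> 0"
      using y[of x] by (auto simp: M_def sum_nonneg_eq_0_iff F_def)
    moreover have "M x \<ge> 0"
      by (simp add: M_def sum_nonneg)
    ultimately show ?thesis
      by simp
  qed
  have cont_M: "continuous_on UNIV M"
    unfolding M_def by (intro continuous_intros)
  \<comment> \<open>One continuous factor covers both regions: where \<open>m x \<ge> e\<close> it
    is 1, because \<open>g x = 0\<close> forces \<open>M x = m x\<close>; elsewhere it is
    \<open>e / M x\<close>, which makes the norms of the entries sum to \<open>e\<close>. It is
    positive everywhere, so no new zeros arise.\<close>
  define u where "u = (\<lambda>j\<in>{..<n}. Bcontfun (\<lambda>x. F j x * of_real (max (m x) e / M x)))"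
  have u: "u j x = F j x * of_real (max (m x) e / M x)" if "j < n" for j x
    using that unfolding u_def
    by (simp del: of_real_divide)
       (intro apply_Bcontfun_compact X continuous_intros cont_m cont_M, use M in \<open>metis less_irrefl\<close>)
  have "u \<in> invertible_tuples n"
    unfolding invertible_tuples_iff[OF X]
  proof (intro conjI allI)
    show "u \<in> tuples n UNIV"
      by (simp add: u_def tuples_def)
    fix x
    obtain j where "j < n" "F j x \<noteq> 0"
      using y[of x] by (auto simp: F_def)
    moreover have "max (m x) e / M x \<noteq> 0"
      using e M[of x] by (auto simp: max_def)
    ultimately show "\<exists>j<n. u j x \<noteq> 0"
      using u by (metis mult_eq_0_iff of_real_eq_0_iff)
  qed
  moreover have "norm (u j - f j) < \<epsilon>" if j: "j < n" for j
  proof -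
    have "norm ((u j - f j) x) \<le> 2 * e" for x
    proof (cases "m x \<ge> e")
      case True
      then have "F i x = f i x" for i
        by (simp add: F_def g)
      moreover from this have "M x = m x"
        by (simp add: M_def m_def)
      ultimately show ?thesis
        using True e by (simp add: u[OF j])
    next
      case False
      have "norm (F j x) \<le> M x" "norm (f j x) \<le> m x"
        unfolding M_def m_def using j by (auto intro!: member_le_sum)
      then have "norm (F j x) * (e / M x) \<le> e"
        using M[of x] e by (simp add: field_simps)
      then have "norm (u j x) \<le> e"
        using False M[of x] e by (simp add: u[OF j] norm_mult norm_divide)
      moreover have "norm (f j x) \<le> e"
        using False \<open>norm (f j x) \<le> m x\<close> by simp
      ultimately show ?thesis
        using norm_triangle_ineq4[of "u j x" "f j x"] by simp
    qed
    then have "norm (u j - f j) \<le> 2 * e"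
      by (rule norm_bound)
    with e show ?thesis
      by simp
  qed
  ultimately show ?thesis
    by blast
qed

text \<open>
  Where \<open>\<bar>g\<bar> \<ge> c\<close>, the correction satisfies \<open>a g = u - f\<close> with \<open>u\<close> invertible and close to \<open>f\<close>;
  where \<open>\<bar>g\<bar> < c\<close>, it is too small to cancel \<open>f\<close>.
\<close>

lemma approximable_imp_small_norm:
  fixes f :: "nat \<Rightarrow> 'x::topological_space \<Rightarrow>\<^sub>C 'k::real_normed_field"
  assumes X: "compact (UNIV :: 'x set)"
    and approx: "\<And>\<epsilon>. \<epsilon> > 0 \<Longrightarrow> \<exists>u \<in> invertible_tuples n. \<forall>j<n. norm (u j - f j) < \<epsilon>"
    and f: "f \<in> tuples n UNIV" and fg: "f(n := g) \<in> invertible_tuples (Suc n)" and "\<epsilon> > 0"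
  shows "\<exists>a \<in> tuples n UNIV. (\<forall>j<n. norm (a j) < \<epsilon>) \<and> add_mult n f a g \<in> invertible_tuples n"
proof -
  have pos: "0 < (\<Sum>j<n. norm (f j x)) + norm (g x)" for x
  proof (cases "g x = 0")
    case True
    then obtain j where "j < n" "f j x \<noteq> 0"
      using fg unfolding invertible_tuples_append_iff[OF X f] by blast
    then have "0 < (\<Sum>j<n. norm (f j x))"
      by (intro sum_pos2[of _ j]) auto
    then show ?thesis
      using True by simp
  next
    case False
    then show ?thesis
      by (intro add_nonneg_pos sum_nonneg) auto
  qed
  have "continuous_on UNIV (\<lambda>x. (\<Sum>j<n. norm (f j x)) + norm (g x))"
    by (intro continuous_intros)
  from compact_positive_lower_bound[OF X this pos]
  obtain \<delta> where \<delta>: "\<delta> > 0" "\<And>x. \<delta> \<le> (\<Sum>j<n. norm (f j x)) + norm (g x)"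
    by metis
  \<comment> \<open>The \<open>n + 1\<close> norms of the \<open>f j x\<close> and of
    \<open>g x\<close> sum to at least \<delta>, so one of them is at least this average.\<close>
  define c where "c = \<delta> / (real n + 1)"
  have c: "c > 0" "real n * c + c = \<delta>"
    using \<delta>(1) by (simp_all add: c_def divide_simps) (simp add: algebra_simps)
  have large: "\<exists>j<n. c \<le> norm (f j x)" if "norm (g x) < c" for x
  proof (rule ccontr)
    assume "\<not> ?thesis"
    then have "(\<Sum>j<n. norm (f j x)) \<le> real n * c"
      using sum_bounded_above[of "{..<n}" "\<lambda>j. norm (f j x)" c] by force
    then show False
      using \<delta>(2)[of x] c that by linarith
  qed
  \<comment> \<open>The bound \<open>c\<close> keeps the correction below some
    \<open>norm (f j x)\<close> where \<open>g\<close> is small; the bound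
    \<open>\<epsilon> * c\<close> compensates the factor \<open>1 / c\<close> that bounds
    \<open>h\<close>.\<close>
  obtain u where u: "u \<in> invertible_tuples n" "\<And>j. j < n \<Longrightarrow> norm (u j - f j) < min c (\<epsilon> * c)"
    using approx[of "min c (\<epsilon> * c)"] c \<open>\<epsilon> > 0\<close> by auto
  \<comment> \<open>A truncated reciprocal of \<open>g\<close>: it equals \<open>1 / g x\<close>
    where \<open>norm (g x) \<ge> c\<close>, and stays continuous and bounded by
    \<open>1 / c\<close> through the zeros of \<open>g\<close>.\<close>
  define h where "h = Bcontfun (\<lambda>x. conjug (g x) / of_real ((max (norm (g x)) c)\<^sup>2))"
  have h: "h x = conjug (g x) / of_real ((max (norm (g x)) c)\<^sup>2)" for x
    unfolding h_def
    by (intro apply_Bcontfun_compact X continuous_intros) (use c in \<open>auto simp: max_def\<close>)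
  have norm_h: "norm (h x) \<le> 1 / c" for x
  proof -
    let ?m = "max (norm (g x)) c"
    have "c * norm (g x) \<le> ?m * ?m"
      by (intro mult_mono) (use c in auto)
    moreover have "0 < ?m"
      using c by simp
    ultimately show ?thesis
      using c by (simp add: h norm_divide norm_mult norm_conjug power2_eq_square field_simps)
  qed
  have norm_hg: "norm (h x * g x) \<le> 1" for x
  proof -
    let ?m = "max (norm (g x)) c"
    have "norm (g x) * norm (g x) \<le> ?m * ?m"
      by (intro mult_mono) (use c in auto)
    moreover have "0 < ?m"
      using c by simp
    ultimately show ?thesis
      using c by (simp add: h norm_divide norm_mult norm_conjug power2_eq_square field_simps)
  qed
  have hg: "h x * g x = 1" if "norm (g x) \<ge> c" for x
  proof -
    have "g x \<noteq> 0"
      using that c by auto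
    then show ?thesis
      using that by (simp add: h conjug_mult max_def)
  qed
  define a where "a = (\<lambda>j\<in>{..<n}. (u j - f j) * h)"
  have "norm (a j) < \<epsilon>" if "j < n" for j
  proof -
    have "norm (a j) \<le> norm (u j - f j) * norm h"
      using that by (simp add: a_def norm_mult_ineq)
    also have "\<dots> \<le> norm (u j - f j) * (1 / c)"
      by (intro mult_left_mono norm_bound norm_h norm_ge_zero)
    also have "\<dots> < \<epsilon>"
      using u(2)[OF that] c by (simp add: field_simps)
    finally show ?thesis .
  qed
  moreover have "add_mult n f a g \<in> invertible_tuples n"
    unfolding add_mult_in_invertible_tuples_iff[OF X]
  proof
    fix x
    show "\<exists>j<n. f j x + a j x * g x \<noteq> 0"
    proof (cases "norm (g x) \<ge> c")
      case True
      obtain j where "j < n" "u j x \<noteq> 0"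
        using u(1) unfolding invertible_tuples_iff[OF X] by blast
      moreover have "f j x + a j x * g x = u j x"
        using hg[OF True] \<open>j < n\<close> by (simp add: a_def mult.assoc)
      ultimately show ?thesis
        by auto
    next
      case False
      then obtain j where j: "j < n" "c \<le> norm (f j x)"
        using large[of x] by auto
      have "norm (a j x * g x) = norm ((u j - f j) x) * norm (h x * g x)"
        using j by (simp add: a_def norm_mult)
      also have "\<dots> \<le> norm ((u j - f j) x)"
        using mult_left_mono[OF norm_hg[of x] norm_ge_zero] by simp
      also have "\<dots> \<le> norm (u j - f j)"
        by (rule norm_bounded)
      also have "\<dots> < norm (f j x)"
        using u(2)[OF j(1)] j(2) by simp
      \<comment> \<open>A vanishing sum would force both summands to have the same norm.\<close>
      finally have "f j x + a j x * g x \<noteq> 0"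
        by (metis add_eq_0_iff less_irrefl norm_minus_cancel)
      with j(1) show ?thesis
        by blast
    qed
  qed
  ultimately show ?thesis
    by (intro bexI[of _ a]) (auto simp: a_def tuples_def)
qed

text \<open>
  A sign \<open>s\<close> is fixed so that \<open>f + s g\<close> does not vanish at a chosen point \<open>x0\<close>. With a cut-off \<open>\<phi>\<close>
  vanishing at \<open>x0\<close>, the tuple \<open>s (1 - \<eta> \<phi>) + \<phi> a\<close> with \<open>\<bar>a\<bar> < \<eta>\<close> is bounded by \<open>1\<close> and attains
  this bound at \<open>x0\<close>.
\<close>

lemma small_norm_imp_unit_norm_one:
  fixes f :: "nat \<Rightarrow> 'x::topological_space \<Rightarrow>\<^sub>C 'k::real_normed_field"
  assumes X: "compact (UNIV :: 'x set)" and n: "n \<ge> 1"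
    and small: "\<And>(f :: nat \<Rightarrow> 'x \<Rightarrow>\<^sub>C 'k) g \<epsilon>. f \<in> tuples n UNIV \<Longrightarrow>
      f(n := g) \<in> invertible_tuples (Suc n) \<Longrightarrow> \<epsilon> > 0 \<Longrightarrow>
      \<exists>a \<in> tuples n UNIV. (\<forall>j<n. norm (a j) < \<epsilon>) \<and> add_mult n f a g \<in> invertible_tuples n"
    and f: "f \<in> tuples n UNIV" and fg: "f(n := g) \<in> invertible_tuples (Suc n)"
  shows "\<exists>c \<in> tuples n {v. v dvd 1}. (\<forall>j<n. norm (c j) = 1) \<and>
    add_mult n f c g \<in> invertible_tuples n"
proof -
  \<comment> \<open>An arbitrary point; the norm 1 will be attained here.\<close>
  define x0 :: 'x where "x0 = undefined"
  obtain s :: "'k" and i where s: "s \<in> {1, -1}" and i: "i < n" "f i x0 + s * g x0 \<noteq> 0"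
  proof (cases "g x0 = 0")
    case True
    then obtain j where "j < n" "f j x0 \<noteq> 0"
      using fg unfolding invertible_tuples_append_iff[OF X f] by blast
    then show ?thesis
      using that[of 1 j] True by simp
  next
    case False
    \<comment> \<open>If both signs failed, subtracting would give
      \<open>2 * g x0 = 0\<close>.\<close>
    then have "f 0 x0 + 1 * g x0 \<noteq> 0 \<or> f 0 x0 + (-1) * g x0 \<noteq> 0"
      by (auto simp: add_eq_0_iff)
    then show ?thesis
      using that[of 1 0] that[of "-1" 0] n by auto
  qed
  have norm_s: "norm s = 1"
    using s by auto
  define p where "p x = norm (f i x + s * g x)" for x
  have p0: "p x0 > 0"
    using i by (simp add: p_def)
  \<comment> \<open>The cut-off is built from \<open>p\<close> itself: it reaches 1 as soon as
    \<open>p\<close> deviates from \<open>p x0\<close> by half of that value, so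
    \<open>\<phi> x < 1\<close> keeps \<open>p x\<close> above \<open>p x0 / 2\<close>.\<close>
  define \<phi> where "\<phi> x = min 1 (\<bar>p x - p x0\<bar> / (p x0 / 2))" for x
  have cont_\<phi>: "continuous_on UNIV \<phi>"
    unfolding \<phi>_def p_def by (intro continuous_intros) (use p0 in \<open>auto simp: p_def\<close>)
  have \<phi>: "0 \<le> \<phi> x" "\<phi> x \<le> 1" "\<phi> x0 = 0" for x
    using p0 by (auto simp: \<phi>_def)
  have \<phi>_lt: "p x > p x0 / 2" if "\<phi> x < 1" for x
    using that p0 by (auto simp: \<phi>_def min_def abs_if field_simps split: if_splits)
  \<comment> \<open>The bound 1/4 lets the leading term of \<open>c\<close> dominate its
    perturbation; the other bound gives \<open>2 * \<eta> * norm g < p x0 / 2\<close>, with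
    \<open>+ 1\<close> guarding against \<open>norm g = 0\<close>.\<close>
  define \<eta> where "\<eta> = min (1 / 4) (p x0 / (8 * (norm g + 1)))"
  have "norm g + 1 > 0"
    using norm_ge_zero[of g] by linarith
  then have \<eta>: "\<eta> > 0" "\<eta> \<le> 1 / 4"
    using p0 unfolding \<eta>_def by (simp, intro min.cobounded1)
  have \<eta>g: "2 * \<eta> * norm g < p x0 / 2"
  proof -
    have "\<eta> * (norm g + 1) \<le> p x0 / (8 * (norm g + 1)) * (norm g + 1)"
      using \<open>norm g + 1 > 0\<close> by (intro mult_right_mono) (auto simp: \<eta>_def)
    also have "\<dots> = p x0 / 8"
      using \<open>norm g + 1 > 0\<close> by (simp add: field_simps)
    finally have "\<eta> * norm g + \<eta> \<le> p x0 / 8"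
      by (simp add: algebra_simps)
    then show ?thesis
      using \<eta>(1) p0 by linarith
  qed
  \<comment> \<open>Shrinking \<open>s\<close> by the factor \<open>1 - \<eta> * \<phi> x\<close>
    leaves exactly the room that the later term \<open>\<phi> a\<close>, of norm at most
    \<open>\<eta> * \<phi> x\<close>, may use without exceeding 1.\<close>
  define k where "k = Bcontfun (\<lambda>x. s * of_real (1 - \<eta> * \<phi> x))"
  have k: "k x = s * of_real (1 - \<eta> * \<phi> x)" for x
    unfolding k_def by (intro apply_Bcontfun_compact X continuous_intros cont_\<phi>)
  define \<Phi> where "\<Phi> = Bcontfun (\<lambda>x. of_real (\<phi> x) :: 'k)"
  have \<Phi>: "\<Phi> x = of_real (\<phi> x)" for x
    unfolding \<Phi>_def by (intro apply_Bcontfun_compact X continuous_intros cont_\<phi>)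
  \<comment> \<open>The small correction is taken for \<open>f + k g\<close>, which agrees with
    \<open>f\<close> on the zeros of \<open>g\<close>; thus appending \<open>g\<close> still gives
    an invertible tuple.\<close>
  define f' where "f' = (\<lambda>j\<in>{..<n}. f j + k * g)"
  have f': "f' \<in> tuples n UNIV"
    by (simp add: f'_def tuples_def)
  have "f'(n := g) \<in> invertible_tuples (Suc n)"
    using fg unfolding invertible_tuples_append_iff[OF X f] invertible_tuples_append_iff[OF X f']
    by (force simp: f'_def)
  from small[OF f' this \<eta>(1)] obtain a :: "nat \<Rightarrow> 'x \<Rightarrow>\<^sub>C 'k" where
    a: "\<And>j. j < n \<Longrightarrow> norm (a j) < \<eta>" and nz: "\<And>x. \<exists>j<n. f' j x + a j x * g x \<noteq> 0"
    unfolding add_mult_in_invertible_tuples_iff[OF X] by blast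
  have norm_a: "norm (a j x) \<le> \<eta>" if "j < n" for j x
    using norm_bounded[of "a j" x] a[OF that] by linarith
  define c where "c = (\<lambda>j\<in>{..<n}. k + \<Phi> * a j)"
  have c: "c j x = s * of_real (1 - \<eta> * \<phi> x) + of_real (\<phi> x) * a j x" if "j < n" for j x
    using that by (simp add: c_def k \<Phi>)
  have \<eta>\<phi>: "0 \<le> \<eta> * \<phi> x" "\<eta> * \<phi> x \<le> \<eta>" for x
    using \<eta> \<phi>(1,2)[of x] by (auto simp: mult_left_le)
  have norm_k: "norm (s * of_real (1 - \<eta> * \<phi> x)) = 1 - \<eta> * \<phi> x" for x
  proof -
    have "0 \<le> 1 - \<eta> * \<phi> x"
      using \<eta>\<phi>[of x] \<eta> by linarith
    then show ?thesis
      unfolding norm_mult norm_of_real norm_s by simp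
  qed
  have norm_\<Phi>a: "norm (of_real (\<phi> x) * a j x) \<le> \<eta> * \<phi> x" if "j < n" for j x
    unfolding norm_mult norm_of_real
    using mult_left_mono[OF norm_a[OF that, of x] \<phi>(1)[of x]] \<phi>(1)[of x] by (simp add: mult.commute)
  have "norm (c j) = 1" if j: "j < n" for j
  proof (rule antisym)
    show "norm (c j) \<le> 1"
    proof (rule norm_bound)
      fix x
      show "norm (c j x) \<le> 1"
        unfolding c[OF j]
        using norm_triangle_ineq[of "s * of_real (1 - \<eta> * \<phi> x)" "of_real (\<phi> x) * a j x"]
          norm_k[of x] norm_\<Phi>a[OF j, of x] by linarith
    qed
    have "norm (c j x0) = 1"
      by (simp add: c[OF j] \<phi> norm_s)
    then show "1 \<le> norm (c j)"
      using norm_bounded[of "c j" x0] by simp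
  qed
  moreover have "c j dvd 1" if j: "j < n" for j
  proof (rule unit_bcontfunI[OF X])
    fix x
    have "norm (s * of_real (1 - \<eta> * \<phi> x)) > norm (of_real (\<phi> x) * a j x)"
      using norm_k[of x] norm_\<Phi>a[OF j, of x] \<eta>\<phi>[of x] \<eta> by linarith
    then show "c j x \<noteq> 0"
      unfolding c[OF j] by (metis add_eq_0_iff less_irrefl norm_minus_cancel)
  qed
  moreover have "add_mult n f c g \<in> invertible_tuples n"
    unfolding add_mult_in_invertible_tuples_iff[OF X]
  proof
    fix x
    show "\<exists>j<n. f j x + c j x * g x \<noteq> 0"
    \<comment> \<open>Where \<open>\<phi> x = 1\<close>, \<open>c\<close> equals
      \<open>k + a\<close> and the choice of \<open>a\<close> applies. Elsewhere entry
      \<open>i\<close> alone suffices: it differs from \<open>f i x + s * g x\<close>, of norm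
      \<open>p x > p x0 / 2\<close>, by at most \<open>2 * \<eta> * norm g\<close>.\<close>
    proof (cases "\<phi> x < 1")
      case False
      then have "\<phi> x = 1"
        using \<phi>(2)[of x] by simp
      then show ?thesis
        using nz[of x] by (auto simp: f'_def c k algebra_simps)
    next
      case True
      let ?d = "of_real (\<phi> x) * a i x - s * of_real (\<eta> * \<phi> x)"
      have "norm ?d \<le> 2 * \<eta>"
        using norm_triangle_ineq4[of "of_real (\<phi> x) * a i x" "s * of_real (\<eta> * \<phi> x)"]
          norm_\<Phi>a[OF i(1), of x] \<eta>\<phi>[of x]
        unfolding norm_mult[of s] norm_of_real norm_s by linarith
      then have "norm (?d * g x) \<le> 2 * \<eta> * norm g"
        unfolding norm_mult using \<eta> by (intro mult_mono norm_bounded) auto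
      then have "norm (?d * g x) < norm (f i x + s * g x)"
        using \<eta>g \<phi>_lt[OF True] by (simp add: p_def)
      then have "(f i x + s * g x) + ?d * g x \<noteq> 0"
        by (metis add_eq_0_iff less_irrefl norm_minus_cancel)
      moreover have "f i x + c i x * g x = (f i x + s * g x) + ?d * g x"
        by (simp add: c[OF i(1)] algebra_simps)
      ultimately show ?thesis
        using i(1) by metis
    qed
  qed
  ultimately show ?thesis
    by (intro bexI[of _ c]) (auto simp: c_def tuples_def)
qed

section \<open>Density in the product topology as uniform approximation of the entries\<close>

text \<open>With finitely many factors, products of balls are open, and each basic neighbourhood
  contains such a product with one common radius, the least of the finitely many radii.\<close>

lemma dense_invertible_tuples_iff:
  "product_topology (\<lambda>_. euclidean) {..<n} closure_of invertible_tuples n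
      = (tuples n UNIV :: (nat \<Rightarrow> 'a::{comm_ring_1, real_normed_vector}) set) \<longleftrightarrow>
   (\<forall>f \<in> tuples n UNIV. \<forall>\<epsilon>>0. \<exists>u \<in> (invertible_tuples n :: (nat \<Rightarrow> 'a) set).
      \<forall>j<n. norm (u j - f j) < \<epsilon>)"
    (is "?T closure_of ?U = ?A \<longleftrightarrow> ?R")
proof -
  have top: "topspace ?T = ?A"
    by (simp add: tuples_def)
  have U: "?U \<subseteq> ?A"
    by (auto simp: invertible_tuples_def)
  show ?thesis
  proof
    assume dense: "?T closure_of ?U = ?A"
    show ?R
    proof (intro ballI allI impI)
      fix f :: "nat \<Rightarrow> 'a" and \<epsilon> :: real
      assume f: "f \<in> ?A" and "\<epsilon> > 0"
      let ?V = "\<Pi>\<^sub>E j\<in>{..<n}. ball (f j) \<epsilon>"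
      have "openin ?T ?V"
        by (simp add: openin_PiE_gen)
      moreover have "f \<in> ?V"
        using f \<open>\<epsilon> > 0\<close> by (simp add: tuples_def PiE_iff)
      ultimately obtain u where "u \<in> ?U" "u \<in> ?V"
        using f unfolding dense[symmetric] in_closure_of by blast
      then show "\<exists>u\<in>?U. \<forall>j<n. norm (u j - f j) < \<epsilon>"
        by (intro bexI[of _ u]) (simp_all add: PiE_iff dist_norm norm_minus_commute)
    qed
  next
    assume R: ?R
    have "f \<in> ?T closure_of ?U" if f: "f \<in> ?A" for f
      unfolding in_closure_of
    proof (intro conjI allI impI; (elim conjE)?)
      show "f \<in> topspace ?T"
        using f top by simp
      fix V
      assume "f \<in> V" "openin ?T V"
      then obtain W where "\<forall>j\<in>{..<n}. openin euclidean (W j)"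
        and W: "f \<in> Pi\<^sub>E {..<n} W" "Pi\<^sub>E {..<n} W \<subseteq> V"
        unfolding openin_product_topology_alt by meson
      then have "f j \<in> W j" "open (W j)" if "j < n" for j
        using that by (simp_all add: PiE_iff)
      then have "\<forall>j\<in>{..<n}. \<exists>e>0. ball (f j) e \<subseteq> W j"
        unfolding open_contains_ball by simp
      then obtain e where e: "\<And>j. j < n \<Longrightarrow> e j > 0 \<and> ball (f j) (e j) \<subseteq> W j"
        by (auto dest!: bchoice)
      \<comment> \<open>The inserted 1 keeps the set nonempty when \<open>n = 0\<close>.\<close>
      define d where "d = Min (insert 1 (e ` {..<n}))"
      have "d > 0" and d: "\<And>j. j < n \<Longrightarrow> d \<le> e j"
        using e by (auto simp: d_def)
      then obtain u where u: "u \<in> ?U" "\<And>j. j < n \<Longrightarrow> norm (u j - f j) < d"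
        using R f by blast
      have "u j \<in> W j" if "j < n" for j
      proof -
        have "u j \<in> ball (f j) (e j)"
          using u(2)[OF that] d[OF that] by (simp add: dist_norm norm_minus_commute)
        then show ?thesis
          using e[OF that] by blast
      qed
      moreover have "u \<in> ?A"
        using u(1) U by blast
      ultimately have "u \<in> Pi\<^sub>E {..<n} W"
        by (simp add: tuples_def PiE_iff)
      then have "u \<in> V"
        using W(2) by blast
      with u(1) show "\<exists>y. y \<in> ?U \<and> y \<in> V"
        by blast
    qed
    then show "?T closure_of ?U = ?A"
      using closure_of_subset_topspace[of ?T ?U] unfolding top by blast
  qed
qed

section \<open>Equality of the six ranks\<close>

text \<open>Entry 0 exists because \<open>n \<ge> 1\<close>, and being a unit it has no
  zeros.\<close>

lemma unit_tuple_invertible: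
  fixes u :: "nat \<Rightarrow> 'x::topological_space \<Rightarrow>\<^sub>C 'k::real_normed_field"
  assumes "compact (UNIV :: 'x set)" "n \<ge> 1" "u \<in> tuples n {v. v dvd 1}"
  shows "u \<in> invertible_tuples n"
  unfolding invertible_tuples_iff[OF assms(1)]
proof (intro conjI allI)
  show "u \<in> tuples n UNIV"
    using assms(3) by (auto simp: tuples_def)
  fix x
  have "u 0 dvd 1"
    using PiE_mem[OF assms(3)[unfolded tuples_def], of 0] assms(2) by simp
  then obtain v where "1 = u 0 * v" ..
  then have "u 0 x * v x = 1"
    by (metis apply_one_bcontfun apply_times_bcontfun)
  then have "u 0 x \<noteq> 0"
    by (metis mult_zero_left zero_neq_one)
  with assms(2) show "\<exists>j<n. u j x \<noteq> 0"
    by (intro exI[of _ 0]) auto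
qed

text \<open>Allows the rank conditions to be compared under \<open>n \<ge> 1\<close>, which the
  construction of norm-one units and \<open>unit_tuple_invertible\<close> rely on.\<close>

lemma least_rank_cong:
  assumes "\<And>n. n \<ge> 1 \<Longrightarrow> P n \<longleftrightarrow> Q n"
  shows "least_rank P = least_rank Q"
proof -
  have "(\<lambda>n. n \<ge> 1 \<and> P n) = (\<lambda>n. n \<ge> 1 \<and> Q n)"
    using assms by auto
  then show ?thesis
    unfolding least_rank_def by metis
qed

text \<open>The scalars range over any \<open>real_normed_field\<close>, so the real and complex
  cases are both instances.\<close>

lemma stable_ranks_eq:
  fixes R :: "('x::topological_space \<Rightarrow>\<^sub>C 'k::real_normed_field) itself"
  assumes X: "compact (UNIV :: 'x set)"
  shows "bsr R = usr R \<and> usr R = aur R \<and> aur R = tsr R \<and> tsr R = snr R \<and> snr R = nor R"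
proof -
  let ?inv = "\<lambda>n. invertible_tuples n :: (nat \<Rightarrow> 'x \<Rightarrow>\<^sub>C 'k) set"
  let ?rank = "\<lambda>n P. \<forall>f \<in> tuples n UNIV. \<forall>g. f(n := g) \<in> ?inv (Suc n) \<longrightarrow>
    (\<exists>x. P x \<and> add_mult n f x g \<in> ?inv n)"
  let ?bass = "\<lambda>n. ?rank n (\<lambda>x. x \<in> tuples n UNIV)"
  let ?unitary = "\<lambda>n. ?rank n (\<lambda>x. x \<in> ?inv n)"
  let ?units = "\<lambda>n. ?rank n (\<lambda>x. x \<in> tuples n {v. v dvd 1})"
  let ?dense = "\<lambda>n. \<forall>f \<in> tuples n UNIV. \<forall>\<epsilon>>0. \<exists>u \<in> ?inv n. \<forall>j<n. norm (u j - f j) < \<epsilon>"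
  let ?small = "\<lambda>n. \<forall>\<epsilon>>0. ?rank n (\<lambda>x. x \<in> tuples n UNIV \<and> (\<forall>j<n. norm (x j) < \<epsilon>))"
  let ?normone = "\<lambda>n. ?rank n (\<lambda>x. x \<in> tuples n UNIV \<and> (\<forall>j<n. norm (x j) = 1))"
  \<comment> \<open>A common strengthening of \<open>?units\<close> and \<open>?normone\<close>,
    through which both are reached from \<open>?small\<close>.\<close>
  let ?unit_normone =
    "\<lambda>n. ?rank n (\<lambda>x. x \<in> tuples n {v. v dvd 1} \<and> (\<forall>j<n. norm (x j) = 1))"
  have tuples_UNIV: "x \<in> tuples n UNIV" if "x \<in> tuples n S" for x n and S :: "('x \<Rightarrow>\<^sub>C 'k) set"
    using that by (auto simp: tuples_def)
  have inv_tuples: "x \<in> tuples n UNIV" if "x \<in> ?inv n" for x n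
    using that by (simp add: invertible_tuples_def)
  have mono: "?rank n P \<Longrightarrow> (\<And>x. P x \<Longrightarrow> Q x) \<Longrightarrow> ?rank n Q" for n P Q
    by meson
  have "(?unitary n \<longleftrightarrow> ?bass n) \<and> (?units n \<longleftrightarrow> ?bass n) \<and> (?dense n \<longleftrightarrow> ?bass n) \<and>
    (?small n \<longleftrightarrow> ?bass n) \<and> (?normone n \<longleftrightarrow> ?bass n)" if n: "n \<ge> 1" for n
  proof -
    have bass_dense: "?bass n \<Longrightarrow> ?dense n"
      by (intro ballI allI impI, rule bass_imp_approximable[OF X]) blast+
    have dense_small: "?small n" if "?dense n"
    proof (intro allI impI ballI)
      fix \<epsilon> :: real and f :: "nat \<Rightarrow> 'x \<Rightarrow>\<^sub>C 'k" and g
      assume *: "\<epsilon> > 0" "f \<in> tuples n UNIV" "f(n := g) \<in> ?inv (Suc n)"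
      have "\<And>\<epsilon>. \<epsilon> > 0 \<Longrightarrow> \<exists>u \<in> ?inv n. \<forall>j<n. norm (u j - f j) < \<epsilon>"
        using that *(2) by blast
      from approximable_imp_small_norm[OF X this *(2,3,1)]
      show "\<exists>x. (x \<in> tuples n UNIV \<and> (\<forall>j<n. norm (x j) < \<epsilon>)) \<and> add_mult n f x g \<in> ?inv n"
        by blast
    qed
    have small_unit: "?unit_normone n" if "?small n"
    proof (intro allI impI ballI)
      fix f :: "nat \<Rightarrow> 'x \<Rightarrow>\<^sub>C 'k" and g
      assume *: "f \<in> tuples n UNIV" "f(n := g) \<in> ?inv (Suc n)"
      have "\<exists>c \<in> tuples n {v. v dvd 1}. (\<forall>j<n. norm (c j) = 1) \<and> add_mult n f c g \<in> ?inv n"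
      proof (rule small_norm_imp_unit_norm_one[OF X n _ *])
        fix f' :: "nat \<Rightarrow> 'x \<Rightarrow>\<^sub>C 'k" and g' \<epsilon>
        assume "f' \<in> tuples n UNIV" "f'(n := g') \<in> ?inv (Suc n)" "0 < (\<epsilon> :: real)"
        with that show "\<exists>a\<in>tuples n UNIV. (\<forall>j<n. norm (a j) < \<epsilon>) \<and> add_mult n f' a g' \<in> ?inv n"
          by meson
      qed
      then show "\<exists>x. (x \<in> tuples n {v. v dvd 1} \<and> (\<forall>j<n. norm (x j) = 1)) \<and>
          add_mult n f x g \<in> ?inv n"
        by blast
    qed
    have "?unit_normone n \<Longrightarrow> ?units n"
      by (erule mono) blast
    moreover have "?unit_normone n \<Longrightarrow> ?normone n"
      by (erule mono) (blast intro: tuples_UNIV)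
    moreover have "?units n \<Longrightarrow> ?unitary n"
      by (erule mono) (blast intro: unit_tuple_invertible[OF X n])
    moreover have "?unitary n \<Longrightarrow> ?bass n"
      by (erule mono) (blast intro: inv_tuples)
    moreover have "?normone n \<Longrightarrow> ?bass n"
      by (erule mono) blast
    ultimately show ?thesis
      using bass_dense dense_small small_unit by argo
  qed
  note eqs = this
  define B where "B = least_rank ?bass"
  have "bsr R = B"
    unfolding bsr_def B_def Bex_def ..
  moreover have "usr R = B"
    unfolding usr_def B_def Bex_def by (rule least_rank_cong) (drule eqs, argo)
  moreover have "aur R = B"
    unfolding aur_def B_def Bex_def by (rule least_rank_cong) (drule eqs, argo)
  moreover have "tsr R = B"
    unfolding tsr_def B_def dense_invertible_tuples_iff by (rule least_rank_cong) (drule eqs, argo)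
  moreover have "snr R = B"
    unfolding snr_def B_def Bex_def conj_assoc[symmetric]
    by (rule least_rank_cong) (drule eqs, argo)
  moreover have "nor R = B"
    unfolding nor_def B_def Bex_def conj_assoc[symmetric]
    by (rule least_rank_cong) (drule eqs, argo)
  ultimately show ?thesis
    by simp
qed

theorem corollary2p6:
  assumes "compact (UNIV :: 'x::t2_space set)"
  shows "(bsr TYPE('x \<Rightarrow>\<^sub>C real) = usr TYPE('x \<Rightarrow>\<^sub>C real) \<and>
          usr TYPE('x \<Rightarrow>\<^sub>C real) = aur TYPE('x \<Rightarrow>\<^sub>C real) \<and>
          aur TYPE('x \<Rightarrow>\<^sub>C real) = tsr TYPE('x \<Rightarrow>\<^sub>C real) \<and>
          tsr TYPE('x \<Rightarrow>\<^sub>C real) = snr TYPE('x \<Rightarrow>\<^sub>C real) \<and>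
          snr TYPE('x \<Rightarrow>\<^sub>C real) = nor TYPE('x \<Rightarrow>\<^sub>C real)) \<and>
         (bsr TYPE('x \<Rightarrow>\<^sub>C complex) = usr TYPE('x \<Rightarrow>\<^sub>C complex) \<and>
          usr TYPE('x \<Rightarrow>\<^sub>C complex) = aur TYPE('x \<Rightarrow>\<^sub>C complex) \<and>
          aur TYPE('x \<Rightarrow>\<^sub>C complex) = tsr TYPE('x \<Rightarrow>\<^sub>C complex) \<and>
          tsr TYPE('x \<Rightarrow>\<^sub>C complex) = snr TYPE('x \<Rightarrow>\<^sub>C complex) \<and>
          snr TYPE('x \<Rightarrow>\<^sub>C complex) = nor TYPE('x \<Rightarrow>\<^sub>C complex))"
  using assms by (intro conjI) (simp_all add: stable_ranks_eq)

end
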